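(* For any DAG $G^*=(V,E)$ with vertex weights $w:V\to\mathbb{R}_{\ge0}$, \[ \overline{\nu}^{\max}_1(G^* ) \;\ge\; \max_{\mathcal{I}\subseteq V}\ \sum_{\substack{H\in CC(\mathcal{E}_{\mathcal{I}}(G^* ))\\ |V(H)|\ge 2}} \max\{\zeta^{(1)}_{\mathcal{I},H},\zeta^{(2)}_{\mathcal{I},H}\}, \] where the maximum is over atomic intervention sets $\mathcal{I}\subseteq V$, \[ \zeta^{(1)}_{\mathcal{I},H}=\tfrac12\max_{\text{clique } C \text{ of } H}\Big\{ w(V(C)) - \max_{v\in V(C)} w(v)\Big\}, \qquad \zeta^{(2)}_{\mathcal{I},H}=\tfrac12\max_{v\in V(H)} \min\{ w(v),\gamma_{H,v}\}, \] and $\gamma_{H,v}=\sum_{i=1}^t \max\{ w(V(C_i)) : C_i \text{ a clique of } H \text{ with } V(C_i)\subseteq V_i\cap N_H(v)\}$, where $V_1,\dots,V_t$ ($t\ge1$) are the vertex sets of the connected components of $H[V(H)\setminus\{v\}]$ and $N_H(v)$ is the neighborhood of $v$ in $H$.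
   Context: A v-structure is a triple $u\to x\leftarrow y$ with $u,y$ nonadjacent. $[G^*]$ is the Markov equivalence class of $G^*$ (DAGs with the same skeleton and v-structures). An intervention is a subset $S\subseteq V$; an atomic intervention set is identified with a subset $\mathcal{I}\subseteq V$ (each vertex intervened on individually), with cost $w(\mathcal{I})=\sum_{v\in\mathcal{I}}w(v)$; for a set $U$, $w(U)=\sum_{u\in U}w(u)$. The $\mathcal{I}$-essential graph $\mathcal{E}_{\mathcal{I}}(G)$ is obtained from the skeleton of $G$ by orienting, as in $G$, every edge belonging to a v-structure and every edge with exactly one endpoint in some intervention of $\mathcal{I}$, then applying Meek rules R1–R4 until no further edge can be oriented (R1: $a - b$ becomes $a\to b$ if $c\to a$, $c,b$ nonadjacent; R2: if $a\to c\to b$; R3: if $d - a - c$, $d\to b\leftarrow c$, $c,d$ nonadjacent; R4: if $d - a - c$, $d\to c\to b$, $b,d$ nonadjacent). $CC(\mathcal{E}_{\mathcal{I}}(G))$ is the set of chain components: connected components of the undirected graph obtained by deleting all directed edges of $\mathcal{E}_{\mathcal{I}}(G)$, each viewed as an undirected graph $H$. $\mathcal{I}$ is a verifying set for $G$ if $\mathcal{E}_{\mathcal{I}}(G)=G$. $\overline{\nu}_1(G)$ is the minimum cost of an atomic verifying set for $G$, and $\overline{\nu}^{\max}_1(G^* )=\max_{G\in[G^*]}\overline{\nu}_1(G)$. *)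

theory Defs
  imports Complex_Main
begin

text \<open>A directed graph on a finite vertex set V is given by its arc set E :: ('a * 'a) set,
  where (u,x) : E means u -> x.\<close>

definition dag :: "'a set \<Rightarrow> ('a \<times> 'a) set \<Rightarrow> bool" where
  "dag V E \<longleftrightarrow> E \<subseteq> V \<times> V \<and> acyclic E"

definition adj :: "('a \<times> 'a) set \<Rightarrow> 'a \<Rightarrow> 'a \<Rightarrow> bool" where
  "adj E u v \<longleftrightarrow> (u, v) \<in> E \<or> (v, u) \<in> E"

definition skeleton :: "('a \<times> 'a) set \<Rightarrow> ('a \<times> 'a) set" where
  "skeleton E = {(u, v). adj E u v}"

definition vstructs :: "('a \<times> 'a) set \<Rightarrow> ('a \<times> 'a \<times> 'a) set" where
  "vstructs E = {(u, x, y). (u, x) \<in> E \<and> (y, x) \<in> E \<and> u \<noteq> y \<and> \<not> adj E u y}"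

definition mec :: "'a set \<Rightarrow> ('a \<times> 'a) set \<Rightarrow> ('a \<times> 'a) set set" where
  "mec V E = {E'. dag V E' \<and> skeleton E' = skeleton E \<and> vstructs E' = vstructs E}"

text \<open>Mixed graphs: the skeleton of E together with a set Or of oriented arcs; an edge
  is undirected if neither of its orientations is in Or.\<close>
definition undir :: "('a \<times> 'a) set \<Rightarrow> ('a \<times> 'a) set \<Rightarrow> 'a \<Rightarrow> 'a \<Rightarrow> bool" where
  "undir E Or a b \<longleftrightarrow> adj E a b \<and> (a, b) \<notin> Or \<and> (b, a) \<notin> Or"

definition meek_step :: "('a \<times> 'a) set \<Rightarrow> ('a \<times> 'a) set \<Rightarrow> ('a \<times> 'a) set \<Rightarrow> bool" where
  "meek_step E Or Or' \<longleftrightarrow> (\<exists>a b. Or' = insert (a, b) Or \<and> undir E Or a b \<and>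
     ((\<exists>c. (c, a) \<in> Or \<and> c \<noteq> b \<and> \<not> adj E c b) \<comment> \<open>R1\<close>
    \<or> (\<exists>c. (a, c) \<in> Or \<and> (c, b) \<in> Or) \<comment> \<open>R2\<close>
    \<or> (\<exists>c d. undir E Or d a \<and> undir E Or a c \<and> (d, b) \<in> Or \<and> (c, b) \<in> Or
              \<and> c \<noteq> d \<and> \<not> adj E c d) \<comment> \<open>R3\<close>
    \<or> (\<exists>c d. undir E Or d a \<and> undir E Or a c \<and> (d, c) \<in> Or \<and> (c, b) \<in> Or
              \<and> b \<noteq> d \<and> \<not> adj E b d) \<comment> \<open>R4\<close>))"

text \<open>Initial orientation: edges in v-structures, and edges with exactly one endpoint in some
  atomic intervention {v}, v : I (i.e. edges incident to a vertex of I).\<close>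
definition init_orient :: "('a \<times> 'a) set \<Rightarrow> 'a set \<Rightarrow> ('a \<times> 'a) set" where
  "init_orient E I =
     {(u, x). (u, x) \<in> E \<and> (\<exists>y. (u, x, y) \<in> vstructs E \<or> (y, x, u) \<in> vstructs E)}
   \<union> {(a, b). (a, b) \<in> E \<and> (a \<in> I \<or> b \<in> I)}"

definition ess_orient :: "('a \<times> 'a) set \<Rightarrow> 'a set \<Rightarrow> ('a \<times> 'a) set" where
  "ess_orient E I = (THE Or. (init_orient E I, Or) \<in> {(X, Y). meek_step E X Y}\<^sup>*
                            \<and> \<not> (\<exists>Or'. meek_step E Or Or'))"

definition verifying :: "('a \<times> 'a) set \<Rightarrow> 'a set \<Rightarrow> bool" where
  "verifying E I \<longleftrightarrow> ess_orient E I = E"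

definition nu1 :: "'a set \<Rightarrow> ('a \<times> 'a) set \<Rightarrow> ('a \<Rightarrow> real) \<Rightarrow> real" where
  "nu1 V E w = Min ((\<lambda>I. sum w I) ` {I. I \<subseteq> V \<and> verifying E I})"

definition nu1max :: "'a set \<Rightarrow> ('a \<times> 'a) set \<Rightarrow> ('a \<Rightarrow> real) \<Rightarrow> real" where
  "nu1max V E w = Max ((\<lambda>G. nu1 V G w) ` mec V E)"

text \<open>Undirected graphs given by a symmetric edge relation U; connected components of the
  subgraph induced on S.\<close>
definition component :: "'a set \<Rightarrow> ('a \<times> 'a) set \<Rightarrow> 'a \<Rightarrow> 'a set" where
  "component S U v = {u \<in> S. (v, u) \<in> (U \<inter> S \<times> S)\<^sup>*}"

definition components :: "'a set \<Rightarrow> ('a \<times> 'a) set \<Rightarrow> 'a set set" where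
  "components S U = component S U ` S"

definition und_edges :: "('a \<times> 'a) set \<Rightarrow> ('a \<times> 'a) set \<Rightarrow> ('a \<times> 'a) set" where
  "und_edges E Or = {(a, b). undir E Or a b}"

text \<open>Vertex sets of the chain components of E_I(G); the chain component H with vertex set C
  is the undirected graph (C, und_edges restricted to C).\<close>
definition chain_components :: "'a set \<Rightarrow> ('a \<times> 'a) set \<Rightarrow> 'a set \<Rightarrow> 'a set set" where
  "chain_components V E I = components V (und_edges E (ess_orient E I))"

definition clique :: "('a \<times> 'a) set \<Rightarrow> 'a set \<Rightarrow> bool" where
  "clique U K \<longleftrightarrow> (\<forall>x\<in>K. \<forall>y\<in>K. x \<noteq> y \<longrightarrow> (x, y) \<in> U)"

definition zeta1 :: "('a \<times> 'a) set \<Rightarrow> 'a set \<Rightarrow> ('a \<Rightarrow> real) \<Rightarrow> real" where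
  "zeta1 U C w = 1/2 * Max {sum w K - Max (w ` K) | K. K \<subseteq> C \<and> K \<noteq> {} \<and> clique U K}"

definition gamma :: "('a \<times> 'a) set \<Rightarrow> 'a set \<Rightarrow> 'a \<Rightarrow> ('a \<Rightarrow> real) \<Rightarrow> real" where
  "gamma U C v w = (\<Sum>Vi\<in>components (C - {v}) U.
      Max {sum w K | K. K \<subseteq> Vi \<inter> {u \<in> C. (v, u) \<in> U} \<and> clique U K})"

definition zeta2 :: "('a \<times> 'a) set \<Rightarrow> 'a set \<Rightarrow> ('a \<Rightarrow> real) \<Rightarrow> real" where
  "zeta2 U C w = 1/2 * Max ((\<lambda>v. min (w v) (gamma U C v w)) ` C)"

definition lower_bound :: "'a set \<Rightarrow> ('a \<times> 'a) set \<Rightarrow> ('a \<Rightarrow> real) \<Rightarrow> real" where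
  "lower_bound V E w = Max ((\<lambda>I. \<Sum>C\<in>{C \<in> chain_components V E I. 2 \<le> card C}.
        max (zeta1 (und_edges E (ess_orient E I)) C w) (zeta2 (und_edges E (ess_orient E I)) C w))
      ` Pow V)"

end

theory Submission
  imports Defs
begin

text \<open>A verifying set of a DAG meets every covered edge \<open>u \<rightarrow> v\<close> (one where the parents of \<open>v\<close> are \<open>u\<close>
  and the parents of \<open>u\<close>), because no Meek rule can orient such an edge. The undirected edges of an
  interventional essential graph form a chordal graph, and all vertices of a chain component
  have the same directed parents; hence every acyclic orientation of the undirected edges
  without v-structures gives a member of the equivalence class, and its covered edges remain
  covered there. By Dirac's argument a chordal graph has such an orientation
  beginning with any given clique in any order, so that consecutive vertices of the clique are
  joined by covered edges. Listing the clique by decreasing weight, a cover of this path has at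
  least half of the weight of the clique without its first vertex; this gives \<open>\<zeta>\<^sup>1\<close>. For \<open>\<zeta>\<^sup>2\<close> the vertex
  \<open>v\<close> comes first, followed in each component of the rest by a clique of neighbours of \<open>v\<close>: a cover
  avoiding \<open>v\<close> contains the first vertex of each of these cliques, hence at least half of their weight.\<close>

section \<open>The Meek closure\<close>

text \<open>In place of the undirectedness conditions of R3 and R4 only the failure of the v-structure at \<open>a\<close>
  is kept (in R4 this is automatic). This makes the rules monotone, so the result does not depend
  on the order in which Meek steps are taken.\<close>

inductive_set meek_closure :: "('a \<times> 'a) set \<Rightarrow> 'a set \<Rightarrow> ('a \<times> 'a) set"
  for E :: "('a \<times> 'a) set" and I :: "'a set" where
  init: "(a, b) \<in> init_orient E I \<Longrightarrow> (a, b) \<in> meek_closure E I"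
| R1: "(c, a) \<in> meek_closure E I \<Longrightarrow> (a, b) \<in> E \<Longrightarrow> \<not> adj E c b \<Longrightarrow> (a, b) \<in> meek_closure E I"
| R2: "(a, c) \<in> meek_closure E I \<Longrightarrow> (c, b) \<in> meek_closure E I \<Longrightarrow> (a, b) \<in> E \<Longrightarrow>
    (a, b) \<in> meek_closure E I"
| R3: "(a, b) \<in> E \<Longrightarrow> adj E d a \<Longrightarrow> adj E a c \<Longrightarrow> (d, b) \<in> meek_closure E I \<Longrightarrow>
    (c, b) \<in> meek_closure E I \<Longrightarrow> c \<noteq> d \<Longrightarrow> \<not> adj E c d \<Longrightarrow> \<not> ((d, a) \<in> E \<and> (c, a) \<in> E) \<Longrightarrow>
    (a, b) \<in> meek_closure E I"
| R4: "(a, b) \<in> E \<Longrightarrow> adj E d a \<Longrightarrow> adj E a c \<Longrightarrow> (d, c) \<in> meek_closure E I \<Longrightarrow>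
    (c, b) \<in> meek_closure E I \<Longrightarrow> b \<noteq> d \<Longrightarrow> \<not> adj E b d \<Longrightarrow> (a, b) \<in> meek_closure E I"

lemma adj_sym: "adj E a b \<longleftrightarrow> adj E b a"
  by (auto simp: adj_def)

lemma undir_sym: "undir E M a b \<longleftrightarrow> undir E M b a"
  by (auto simp: undir_def adj_def)

lemma init_orient_subset: "init_orient E I \<subseteq> E"
  by (auto simp: init_orient_def vstructs_def)

lemma meek_closure_arc: "(a, b) \<in> meek_closure E I \<Longrightarrow> (a, b) \<in> E"
  by (cases rule: meek_closure.cases) (use init_orient_subset in auto)

lemma meek_closure_subset: "meek_closure E I \<subseteq> E"
  using meek_closure_arc by auto

lemma init_orient_vstruct:
  assumes "(u, x) \<in> E" "(y, x) \<in> E" "u \<noteq> y" "\<not> adj E u y"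
  shows "(u, x) \<in> init_orient E I" "(y, x) \<in> init_orient E I"
  using assms unfolding init_orient_def vstructs_def adj_def by blast+

lemma init_orient_target:
  assumes "a \<in> I \<or> b \<in> I" "adj E a b"
  shows "(a, b) \<in> init_orient E I \<or> (b, a) \<in> init_orient E I"
  using assms unfolding init_orient_def adj_def by blast

lemma init_orient_cases:
  assumes "(a, b) \<in> init_orient E I"
  obtains "a \<in> I" | "b \<in> I" | y where "(y, b) \<in> E" "a \<noteq> y" "\<not> adj E a y"
  using assms unfolding init_orient_def vstructs_def adj_def by blast

definition covered :: "('a \<times> 'a) set \<Rightarrow> 'a \<Rightarrow> 'a \<Rightarrow> bool" where
  "covered E u v \<longleftrightarrow> (u, v) \<in> E \<and> (\<forall>z. (z, v) \<in> E \<longleftrightarrow> z = u \<or> (z, u) \<in> E)"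

text \<open>Values of \<open>f\<close> are compared only across edges, so nonadjacent vertices may
  share a value. Orders of different components can therefore be combined without shifting
  them.\<close>

definition orient :: "('a \<times> 'a) set \<Rightarrow> 'a set \<Rightarrow> ('a \<Rightarrow> nat) \<Rightarrow> ('a \<times> 'a) set" where
  "orient U S f = {(x, y) \<in> U. x \<in> S \<and> y \<in> S \<and> f x < f y}"

text \<open>Expresses that \<open>orient U S f\<close> has no v-structures; read by increasing
  \<open>f\<close> it is the reverse of a perfect elimination ordering.\<close>

definition moral_order :: "('a \<times> 'a) set \<Rightarrow> 'a set \<Rightarrow> ('a \<Rightarrow> nat) \<Rightarrow> bool" where
  "moral_order U S f \<longleftrightarrow> (\<forall>x\<in>S. \<forall>y\<in>S. (x, y) \<in> U \<longrightarrow> f x \<noteq> f y) \<and>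
     (\<forall>x\<in>S. clique U {y \<in> S. (y, x) \<in> U \<and> f y < f x})"

text \<open>The characterisation of finite chordal graphs by simplicial vertices. It passes to
  subsets at once and follows directly from an acyclic orientation without v-structures.\<close>

definition chordal_on :: "('a \<times> 'a) set \<Rightarrow> 'a set \<Rightarrow> bool" where
  "chordal_on U S \<longleftrightarrow> (\<forall>T\<subseteq>S. T \<noteq> {} \<longrightarrow> (\<exists>x\<in>T. clique U {y \<in> T. (x, y) \<in> U}))"

text \<open>Serves both the given DAG with the targets \<open>I\<close> and its reoriented class
  member with a verifying set as targets.\<close>

locale acyclic_arcs =
  fixes E :: "('a \<times> 'a) set" and I :: "'a set"
  assumes acyclic: "acyclic E"
begin

abbreviation "M \<equiv> meek_closure E I"

lemma arc_irrefl: "(a, a) \<notin> E"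
  using acyclic by (meson acyclic_def r_into_trancl)

lemma arc_asym: "(a, b) \<in> E \<Longrightarrow> (b, a) \<notin> E"
  using acyclic by (meson acyclic_def r_into_trancl trancl_into_trancl)

lemma arc_trans: "(a, b) \<in> E \<Longrightarrow> (b, c) \<in> E \<Longrightarrow> adj E a c \<Longrightarrow> (a, c) \<in> E"
  using acyclic unfolding adj_def by (meson acyclic_def r_into_trancl trancl_into_trancl)

section \<open>Agreement of the closure with the essential graph\<close>

lemma meek_step_increasing:
  assumes "meek_step E X Y"
  shows "X \<subset> Y"
  using assms unfolding meek_step_def undir_def by blast

text \<open>An edge undirected in \<open>X\<close> lies in no v-structure of \<open>E\<close>, since
  those are oriented initially. In R1, R3 and R4 the opposite arc \<open>(b, a)\<close> would create
  such a v-structure at \<open>a\<close>, in R2 a cycle; so the arc added is the one in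
  \<open>E\<close>.\<close>

lemma meek_step_sound:
  assumes "meek_step E X Y" "init_orient E I \<subseteq> X" "X \<subseteq> M"
  shows "Y \<subseteq> M"
proof -
  from assms(1) obtain a b where Y: "Y = insert (a, b) X" and ab: "undir E X a b" and
    rule: "(\<exists>c. (c, a) \<in> X \<and> c \<noteq> b \<and> \<not> adj E c b)
    \<or> (\<exists>c. (a, c) \<in> X \<and> (c, b) \<in> X)
    \<or> (\<exists>c d. undir E X d a \<and> undir E X a c \<and> (d, b) \<in> X \<and> (c, b) \<in> X
              \<and> c \<noteq> d \<and> \<not> adj E c d)
    \<or> (\<exists>c d. undir E X d a \<and> undir E X a c \<and> (d, c) \<in> X \<and> (c, b) \<in> X
              \<and> b \<noteq> d \<and> \<not> adj E b d)"
    unfolding meek_step_def by blast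
  have XE: "\<And>x y. (x, y) \<in> X \<Longrightarrow> (x, y) \<in> E" and XM: "\<And>x y. (x, y) \<in> X \<Longrightarrow> (x, y) \<in> M"
    using assms(3) meek_closure_subset by blast+
  have vs: False if "undir E X x y" "(x, y) \<in> E" "(z, y) \<in> E" "x \<noteq> z" "\<not> adj E x z" for x y z
    using that init_orient_vstruct[of x y E z I] assms(2) unfolding undir_def by blast
  have ba: "undir E X b a" and adj: "adj E a b" "adj E b a"
    using ab by (auto simp: undir_def adj_def)
  have "(a, b) \<in> M"
    using rule
  proof (elim disjE exE conjE)
    fix c assume c: "(c, a) \<in> X" "c \<noteq> b" "\<not> adj E c b"
    have "(b, a) \<notin> E"
      using vs[OF ba, of c] c XE adj_sym by metis
    then show ?thesis
      using meek_closure.R1[of c a] c XM adj(1) unfolding adj_def by blast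
  next
    fix c assume c: "(a, c) \<in> X" "(c, b) \<in> X"
    then show ?thesis
      using meek_closure.R2[of a c E I b] XM XE arc_trans[of a c b] adj(1) by blast
  next
    fix c d assume h: "undir E X d a" "undir E X a c" "(d, b) \<in> X" "(c, b) \<in> X" "c \<noteq> d" "\<not> adj E c d"
    have adj': "adj E d a" "adj E a c" "adj E c a"
      using h by (auto simp: undir_def adj_def)
    have n: "\<not> ((d, a) \<in> E \<and> (c, a) \<in> E)"
      using vs[OF h(1), of c] h(5,6) adj_sym by metis
    have "(b, a) \<notin> E"
      using n arc_trans[of d b a] arc_trans[of c b a] XE h(3,4) adj' by blast
    then show ?thesis
      using meek_closure.R3[of a b E d c I] n h XM adj' adj unfolding adj_def by blast
  next
    fix c d assume h: "undir E X d a" "undir E X a c" "(d, c) \<in> X" "(c, b) \<in> X" "b \<noteq> d" "\<not> adj E b d"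
    have adj': "adj E d a" "adj E a c" "adj E c a"
      using h by (auto simp: undir_def adj_def)
    have "(b, a) \<notin> E"
    proof
      assume ba: "(b, a) \<in> E"
      then have "(c, a) \<in> E"
        using arc_trans[of c b a] XE h(4) adj'(3) by blast
      then have "(d, a) \<in> E"
        using arc_trans[of d c a] XE h(3) adj'(1) by blast
      then show False
        using vs[OF h(1), of b] ba h(5,6) adj_sym by metis
    qed
    then show ?thesis
      using meek_closure.R4[of a b E d c I] h XM adj' adj unfolding adj_def by blast
  qed
  then show ?thesis
    using Y assms(3) by blast
qed

lemma meek_reachable_sound:
  assumes "(init_orient E I, X) \<in> {(X, Y). meek_step E X Y}\<^sup>*"
  shows "init_orient E I \<subseteq> X \<and> X \<subseteq> M"
  using assms
proof induction
  case base
  then show ?case by (auto intro: meek_closure.init)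
next
  case (step X Y)
  then show ?case using meek_step_sound[of X Y] meek_step_increasing[of X Y] by blast
qed

text \<open>Closure under R1 and R2 is immediate. For R3 and R4 the undirectedness demanded by a
  Meek step is recovered: if one of the two further edges at \<open>a\<close> were oriented, R1 and
  R2 would already orient \<open>a -> b\<close>.\<close>

lemma meek_stuck_complete:
  assumes "init_orient E I \<subseteq> X" "X \<subseteq> M" "\<not> (\<exists>Y. meek_step E X Y)"
  shows "M \<subseteq> X"
proof -
  have XE: "\<And>x y. (x, y) \<in> X \<Longrightarrow> (x, y) \<in> E"
    using assms(2) meek_closure_subset by blast
  have undirI: "undir E X a b" if "(a, b) \<in> E" "(a, b) \<notin> X" for a b
    using that XE arc_asym unfolding undir_def adj_def by blast
  have undirI': "undir E X a b" if "adj E a b" "(a, b) \<notin> X" "(b, a) \<notin> X" for a b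
    using that unfolding undir_def by blast
  have r1: "(a, b) \<in> X" if "(c, a) \<in> X" "(a, b) \<in> E" "\<not> adj E c b" for a b c
  proof (rule ccontr)
    assume "(a, b) \<notin> X"
    moreover have "c \<noteq> b"
      using that XE arc_asym by blast
    ultimately have "meek_step E X (insert (a, b) X)"
      using undirI that unfolding meek_step_def by blast
    then show False using assms(3) by blast
  qed
  have r2: "(a, b) \<in> X" if "(a, c) \<in> X" "(c, b) \<in> X" "(a, b) \<in> E" for a b c
  proof (rule ccontr)
    assume "(a, b) \<notin> X"
    then have "meek_step E X (insert (a, b) X)"
      using undirI that unfolding meek_step_def by blast
    then show False using assms(3) by blast
  qed
  have r3: "(a, b) \<in> X" if "(a, b) \<in> E" "adj E d a" "adj E a c" "(d, b) \<in> X" "(c, b) \<in> X"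
    "c \<noteq> d" "\<not> adj E c d" "\<not> ((d, a) \<in> E \<and> (c, a) \<in> E)" for a b c d
  proof (rule ccontr)
    assume ab: "(a, b) \<notin> X"
    \<comment> \<open>An arc from \<open>a\<close> to \<open>x\<close> or \<open>y\<close> gives
      \<open>a -> b\<close> by R2; and \<open>x -> a\<close> would force \<open>a -> y\<close> by
      R1, as \<open>y -> a\<close> is then excluded.\<close>
    have *: "(x, a) \<notin> X \<and> (a, x) \<notin> X"
      if "(y, b) \<in> X" "(x, b) \<in> X" "\<not> adj E x y" "adj E y a" "\<not> ((x, a) \<in> E \<and> (y, a) \<in> E)" for x y
    proof -
      have "(a, x) \<notin> X" "(a, y) \<notin> X"
        using r2 ab that \<open>(a, b) \<in> E\<close> by blast+
      moreover have "(x, a) \<notin> X"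
        using r1[of x a y] that calculation XE unfolding adj_def by blast
      ultimately show ?thesis by blast
    qed
    have "undir E X d a" "undir E X a c"
      using *[of c d] *[of d c] that adj_sym undirI' by metis+
    then have "meek_step E X (insert (a, b) X)"
      using undirI[OF that(1) ab] that unfolding meek_step_def by blast
    then show False using assms(3) by blast
  qed
  have r4: "(a, b) \<in> X" if "(a, b) \<in> E" "adj E d a" "adj E a c" "(d, c) \<in> X" "(c, b) \<in> X"
    "b \<noteq> d" "\<not> adj E b d" for a b c d
  proof (rule ccontr)
    assume ab: "(a, b) \<notin> X"
    \<comment> \<open>\<open>d -> a\<close> gives \<open>a -> b\<close> by R1 and
      \<open>a -> c\<close> gives it by R2; \<open>c -> a\<close> and \<open>a -> d\<close> reduce
      to these two by R2 with \<open>d -> c\<close>.\<close>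
    have da: "(d, a) \<notin> X"
      using r1[of d a b] that ab adj_sym by metis
    have ac: "(a, c) \<notin> X"
      using r2[of a c b] that ab by blast
    have ca: "(c, a) \<notin> X"
      using r2[of d c a] arc_trans[of d c a] that da XE by blast
    have ad: "(a, d) \<notin> X"
      using r2[of a d c] arc_trans[of a d c] that ac XE by blast
    have "undir E X d a" "undir E X a c"
      using da ac ca ad that undirI' by blast+
    then have "meek_step E X (insert (a, b) X)"
      using undirI[OF that(1) ab] that unfolding meek_step_def by blast
    then show False using assms(3) by blast
  qed
  have "(a, b) \<in> X" if "(a, b) \<in> M" for a b
    using that
  proof induction
    case (init a b)
    then show ?case using assms(1) by blast
  next
    case (R1 c a b)
    then show ?case using r1 by blast
  next
    case (R2 a c b)
    then show ?case using r2 by blast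
  next
    case (R3 a b d c)
    show ?case by (rule r3[of a b d c]) (use R3 in blast)+
  next
    case (R4 a b d c)
    show ?case by (rule r4[of a b d c]) (use R4 in blast)+
  qed
  then show ?thesis by auto
qed

text \<open>Finiteness provides a maximal reachable orientation, which is stuck. Every stuck
  reachable orientation equals \<open>M\<close>, so the definite description denotes it.\<close>

lemma ess_orient_eq_meek_closure:
  assumes "finite E"
  shows "ess_orient E I = M"
proof -
  let ?R = "{X. (init_orient E I, X) \<in> {(X, Y). meek_step E X Y}\<^sup>*}"
  have "?R \<subseteq> Pow E"
    using meek_reachable_sound meek_closure_subset by blast
  then have "finite ?R"
    using assms finite_subset by blast
  moreover have "init_orient E I \<in> ?R" by simp
  ultimately obtain X where X: "X \<in> ?R" and max: "\<forall>Y\<in>?R. X \<subseteq> Y \<longrightarrow> X = Y"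
    using finite_has_maximal[of ?R] by blast
  have "\<not> (\<exists>Y. meek_step E X Y)"
  proof
    assume "\<exists>Y. meek_step E X Y"
    then obtain Y where Y: "meek_step E X Y" by blast
    then have "Y \<in> ?R"
      using X rtrancl_into_rtrancl[of _ X _ Y] by simp
    then show False
      using max meek_step_increasing[OF Y] by blast
  qed
  moreover have stuck: "Y = M" if "Y \<in> ?R" "\<not> (\<exists>Z. meek_step E Y Z)" for Y
    using that meek_reachable_sound[of Y] meek_stuck_complete[of Y] by blast
  ultimately show ?thesis
    unfolding ess_orient_def using X by (intro the_equality) blast+
qed

section \<open>Common directed parents along undirected edges\<close>

text \<open>Otherwise either R1 orients \<open>b -> c\<close>, or \<open>c -> b\<close> is oriented
  initially as part of a v-structure with \<open>a\<close>.\<close>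

lemma meek_undir_adj:
  assumes "(a, b) \<in> M" "undir E M b c"
  shows "adj E a c"
proof (rule ccontr)
  assume n: "\<not> adj E a c"
  have ab: "(a, b) \<in> E" using assms(1) meek_closure_subset by blast
  have ac: "a \<noteq> c" using assms unfolding undir_def by blast
  from assms(2) consider "(b, c) \<in> E" | "(c, b) \<in> E"
    unfolding undir_def adj_def by blast
  then show False
  proof cases
    case 1
    then show ?thesis
      using meek_closure.R1[OF assms(1) _ n] assms(2) unfolding undir_def by blast
  next
    case 2
    then show ?thesis
      using meek_closure.init[OF init_orient_vstruct(2)[OF ab 2 ac n]] assms(2)
      unfolding undir_def by blast
  qed
qed

text \<open>This is where atomicity of the interventions is used: an arc oriented by a target orients
  every other edge at that target as well. For arbitrary background knowledge it fails.\<close>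

lemma meek_chain:
  assumes "(a, b) \<in> M" "undir E M b c"
  shows "(a, c) \<in> M"
  using assms
proof (induction arbitrary: c)
  case (init a b)
  then have abM: "(a, b) \<in> M" by (blast intro: meek_closure.init)
  then have ab: "(a, b) \<in> E" using meek_closure_subset by blast
  have ac: "adj E a c" using meek_undir_adj abM init by blast
  from init(2) have bc: "adj E b c" "(b, c) \<notin> M" "(c, b) \<notin> M"
    unfolding undir_def by auto
  have initM: "\<And>p. p \<in> init_orient E I \<Longrightarrow> p \<in> M" by (auto intro: meek_closure.init)
  show ?case
    using init(1)
  proof (cases rule: init_orient_cases)
    case 1
    \<comment> \<open>With \<open>a -> b\<close>, the arc \<open>c -> a\<close> would orient
      \<open>c -> b\<close> by R2.\<close>
    have "(c, a) \<notin> M"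
      using meek_closure.R2[of c a E I b] arc_trans[of c a b] abM bc meek_closure_arc adj_sym by metis
    then show ?thesis using init_orient_target[of a I c E] ac 1 initM by blast
  next
    case 2
    then show ?thesis using init_orient_target[of b I c E] bc initM by blast
  next
    case (3 y)
    have ybM: "(y, b) \<in> M" using init_orient_vstruct(2)[OF ab 3] initM by blast
    then have yc: "adj E y c" using meek_undir_adj init by blast
    \<comment> \<open>If \<open>a\<close> and \<open>y\<close> both point to \<open>c\<close>, they
      form a v-structure there. Otherwise R3 orients \<open>c -> b\<close>, or \<open>b -> c\<close>
      makes both of them parents of \<open>c\<close> by transitivity.\<close>
    show ?thesis
    proof (cases "(a, c) \<in> E \<and> (y, c) \<in> E")
      case True
      then show ?thesis using init_orient_vstruct(1) 3 initM by metis
    next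
      case False
      show ?thesis
      proof (cases "(c, b) \<in> E")
        case True
        have "(c, b) \<in> M"
          by (rule meek_closure.R3[OF True, of y a])
            (use yc ac adj_sym ybM abM 3 False in metis)+
        then show ?thesis using bc by blast
      next
        case cb: False
        then have "(b, c) \<in> E" using bc unfolding adj_def by blast
        then show ?thesis using False arc_trans[of a b c] arc_trans[of y b c] ab 3 ac yc by blast
      qed
    qed
  qed
next
  case (R1 d a b)
  have abM: "(a, b) \<in> M" using R1 by (blast intro: meek_closure.R1)
  have ac: "adj E a c" using meek_undir_adj abM R1 by blast
  have ca: "(c, a) \<notin> M"
    using meek_closure.R2[of c a E I b] arc_trans[of c a b] abM R1.prems meek_closure_arc adj_sym
    unfolding undir_def by metis
  \<comment> \<open>If \<open>a\<close> and \<open>c\<close> were joined by an undirected edge, the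
    induction hypothesis for \<open>d -> a\<close> would give \<open>d -> c\<close>, making
    \<open>d\<close> adjacent to \<open>b\<close>.\<close>
  show ?case
  proof (rule ccontr)
    assume "(a, c) \<notin> M"
    then have "(d, c) \<in> M" using R1.IH ac ca unfolding undir_def by blast
    then have "adj E d b" using meek_undir_adj R1.prems undir_sym by metis
    then show False using R1 by blast
  qed
next
  case (R2 a d b)
  have dc: "(d, c) \<in> M" using R2 by blast
  have "adj E a c"
    using meek_undir_adj[OF _ R2.prems] meek_closure.R2[OF R2(1,2,3)] by blast
  then have "(a, c) \<in> E" using arc_trans[of a d c] R2(1) dc meek_closure_arc by metis
  then show ?case using meek_closure.R2[OF R2(1) dc] by blast
next
  case (R3 a b d e)
  have dc: "(d, c) \<in> M" "(e, c) \<in> M" using R3 by blast+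
  have "(a, b) \<in> M" by (rule meek_closure.R3[of a b E d e]) (use R3 in blast)+
  then have ac: "adj E a c" using meek_undir_adj R3.prems by blast
  \<comment> \<open>\<open>c -> a\<close> would make both \<open>d\<close> and \<open>e\<close>
    parents of \<open>a\<close>, against the side condition of R3. Hence R3 applies with
    \<open>c\<close> in place of \<open>b\<close>.\<close>
  have "(c, a) \<notin> E"
    using arc_trans[of d c a] arc_trans[of e c a] meek_closure_arc[OF dc(1)] meek_closure_arc[OF dc(2)]
      R3(2,3,8) adj_sym[of E a e] by blast
  then have "(a, c) \<in> E" using ac unfolding adj_def by blast
  then show ?case by (rule meek_closure.R3[of a c E d e]) (use R3 dc in blast)+
next
  case (R4 a b d e)
  have ec: "(e, c) \<in> M" using R4 by blast
  then have ecE: "(e, c) \<in> E" and deE: "(d, e) \<in> E"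
    using meek_closure_arc R4.hyps(4) by metis+
  have abM: "(a, b) \<in> M" by (rule meek_closure.R4[of a b E d e]) (use R4 in blast)+
  then have ac: "adj E a c" using meek_undir_adj R4.prems by blast
  \<comment> \<open>Adjacency would give \<open>d -> c\<close> by R2, hence make \<open>d\<close>
    adjacent to \<open>b\<close>.\<close>
  have ndc: "\<not> adj E d c"
  proof
    assume "adj E d c"
    then have "(d, c) \<in> M"
      using arc_trans[OF deE ecE] meek_closure.R2[OF R4.hyps(4) ec] by blast
    then have "adj E d b" using meek_undir_adj R4.prems undir_sym by metis
    then show False using R4.hyps adj_sym by metis
  qed
  have "c \<noteq> d" using arc_asym deE ecE by blast
  \<comment> \<open>\<open>c -> a\<close> would give \<open>d -> a\<close> through \<open>e\<close>,
    hence a v-structure at \<open>a\<close>; R2 with \<open>a -> b\<close> would then orient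
    \<open>c -> b\<close>.\<close>
  have "(c, a) \<notin> E"
  proof
    assume ca: "(c, a) \<in> E"
    then have "(e, a) \<in> E" using arc_trans[OF ecE ca] R4.hyps(3) adj_sym by metis
    then have "(d, a) \<in> E" using arc_trans[OF deE] R4.hyps(2) by blast
    then have "(c, a) \<in> M"
      using ca ndc \<open>c \<noteq> d\<close> init_orient_vstruct(2) meek_closure.init by metis
    moreover have "adj E c b" using R4.prems adj_sym unfolding undir_def by metis
    ultimately have "(c, b) \<in> M"
      using meek_closure.R2[OF _ abM] arc_trans[OF ca R4.hyps(1)] by blast
    then show False using R4.prems unfolding undir_def by blast
  qed
  then have "(a, c) \<in> E" using ac unfolding adj_def by blast
  then show ?case
    by (rule meek_closure.R4[of a c E d e]) (use R4.hyps ec ndc \<open>c \<noteq> d\<close> adj_sym in metis)+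
qed


text \<open>Apart from \<open>a\<close> itself, \<open>a\<close> and \<open>b\<close> have the same
  parents. So a v-structure at \<open>b\<close> or an instance of R1 would have adjacent ends, R2
  would need a cycle, R3 would make both \<open>d\<close> and \<open>c\<close> parents of
  \<open>a\<close>, and R4 would make \<open>d\<close> adjacent to \<open>b\<close>. Only
  orientation by a target remains.\<close>

lemma verifying_meets_covered:
  assumes "(a, b) \<in> M" "covered E a b"
  shows "a \<in> I \<or> b \<in> I"
  using assms
proof induction
  case (init a b)
  show ?case
    using init(1)
  proof (cases rule: init_orient_cases)
    case (3 y)
    then have "(y, a) \<in> E" using init(2) unfolding covered_def by metis
    then show ?thesis using 3 unfolding adj_def by blast
  qed auto
next
  case (R1 c a b)
  then show ?case using meek_closure_arc[of c a] unfolding covered_def adj_def by blast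
next
  case (R2 a c b)
  have "(a, c) \<in> E" "(c, b) \<in> E" using R2 meek_closure_arc by metis+
  moreover have "c \<noteq> a" using calculation(1) arc_irrefl by blast
  ultimately have "(c, a) \<in> E" using R2.prems unfolding covered_def by blast
  then show ?case using \<open>(a, c) \<in> E\<close> arc_asym by blast
next
  case (R3 a b d c)
  have "(d, b) \<in> E" "(c, b) \<in> E" using R3.hyps meek_closure_arc by metis+
  moreover have "d \<noteq> a" "c \<noteq> a" using R3.hyps arc_irrefl unfolding adj_def by blast+
  ultimately show ?case using R3.prems R3.hyps(8) unfolding covered_def by blast
next
  case (R4 a b d c)
  have dc: "(d, c) \<in> E" and cb: "(c, b) \<in> E" using R4.hyps meek_closure_arc by metis+
  have "c \<noteq> a" using R4.hyps arc_irrefl unfolding adj_def by blast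
  then have "(c, a) \<in> E" using R4.prems cb unfolding covered_def by blast
  then have "(d, a) \<in> E" using arc_trans[OF dc] R4.hyps(2) by blast
  then have "(d, b) \<in> E" using R4.prems unfolding covered_def by blast
  then show ?case using R4.hyps(7) unfolding adj_def by blast
qed

section \<open>Reorienting the undirected part\<close>

abbreviation "U \<equiv> und_edges E M"

lemma und_edgesD:
  assumes "(x, y) \<in> U"
  shows "(y, x) \<in> U" "x \<noteq> y" "adj E x y" "(x, y) \<notin> M" "undir E M x y"
  using assms arc_irrefl unfolding und_edges_def undir_def adj_def by auto

lemma adj_cases: "adj E x y \<longleftrightarrow> (x, y) \<in> M \<or> (y, x) \<in> M \<or> (x, y) \<in> U"
  using meek_closure_arc[of x y E I] meek_closure_arc[of y x E I]
  unfolding und_edges_def undir_def adj_def by blast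

lemma meek_chain_edge: "(a, b) \<in> M \<Longrightarrow> (b, c) \<in> U \<Longrightarrow> (a, c) \<in> M"
  using meek_chain und_edgesD(5) by blast

text \<open>A triangle cannot have exactly one directed edge: by \<open>meek_chain\<close> the tail
  of that edge would also have a directed edge to the third vertex.\<close>

lemma und_edges_triangle:
  assumes "(y, x) \<in> U" "(z, x) \<in> U" "adj E y z"
  shows "(y, z) \<in> U"
  using assms adj_cases[of y z] meek_chain_edge[of y z x] meek_chain_edge[of z y x]
    und_edgesD(4)[of y x] und_edgesD(4)[of z x] by blast

lemma und_edges_moral:
  assumes "(y, x) \<in> U" "(z, x) \<in> U" "(y, x) \<in> E" "(z, x) \<in> E" "y \<noteq> z"
  shows "(y, z) \<in> U"
proof (rule und_edges_triangle[OF assms(1,2)], rule ccontr)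
  assume "\<not> adj E y z"
  then have "(y, x) \<in> M"
    using init_orient_vstruct(1)[OF assms(3,4,5)] meek_closure.init by metis
  then show False using und_edgesD(4) assms(1) by blast
qed

lemma chordal_und_edges:
  assumes "finite S"
  shows "chordal_on U S"
  unfolding chordal_on_def
proof (intro allI impI)
  fix T assume T: "T \<subseteq> S" "T \<noteq> {}"
  \<comment> \<open>A minimal element for the converse is a sink of \<open>E\<close> within
    \<open>T\<close>. All its undirected neighbours there are parents, pairwise joined by
    \<open>und_edges_moral\<close>.\<close>
  have "wf (E\<inverse> \<inter> T \<times> T)"
  proof (rule finite_acyclic_wf)
    show "finite (E\<inverse> \<inter> T \<times> T)" using T assms finite_subset by blast
    show "acyclic (E\<inverse> \<inter> T \<times> T)"
      using acyclic acyclic_subset[of "E\<inverse>" "E\<inverse> \<inter> T \<times> T"] by simp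
  qed
  then obtain x where x: "x \<in> T" "\<And>y. (y, x) \<in> E\<inverse> \<inter> T \<times> T \<Longrightarrow> y \<notin> T"
    using T(2) wfE_min' by metis
  then have "clique U {y \<in> T. (x, y) \<in> U}"
    using und_edges_moral und_edgesD(1,3) unfolding clique_def adj_def by blast
  then show "\<exists>x\<in>T. clique U {y \<in> T. (x, y) \<in> U}" using x by blast
qed

text \<open>Arcs of \<open>M\<close> are inherited across undirected edges. So a cycle reduces to
  one of old arcs only or new arcs only, a v-structure cannot mix the two kinds, and the ends of a
  new arc have the same parents in \<open>M\<close>.\<close>

lemma meek_closure_reorient:
  assumes V: "finite V" "E \<subseteq> V \<times> V" and f: "moral_order U V f"
  defines "E' \<equiv> M \<union> orient U V f"
  shows "E' \<in> mec V E"
    and "covered (orient U V f) x y \<Longrightarrow> covered E' x y"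
proof -
  let ?D = "orient U V f"
  have UV: "x \<in> V" "y \<in> V" if "(x, y) \<in> U" for x y
    using und_edgesD(3)[OF that] V(2) unfolding adj_def by blast+
  have DU: "(x, y) \<in> U" "f x < f y" if "(x, y) \<in> ?D" for x y
    using that unfolding orient_def by auto
  have UD: "(x, y) \<in> ?D \<or> (y, x) \<in> ?D" if "(x, y) \<in> U" for x y
    using f UV[OF that] that und_edgesD(1)[OF that] unfolding moral_order_def orient_def
    by (force simp: neq_iff)
  have MD: "(a, c) \<in> M" if "(a, b) \<in> M" "(b, c) \<in> ?D" for a b c
    using meek_chain_edge that DU by blast
  \<comment> \<open>The last arc of a path in \<open>M\<close> can be redirected along each
    following arc of \<open>?D\<close>.\<close>
  have absorb: "(a, c) \<in> M\<^sup>+" if "(a, b) \<in> M\<^sup>+" "(b, c) \<in> ?D\<^sup>*" for a b c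
    using that(2,1)
  proof induction
    case (step y z)
    then have "(a, y) \<in> M\<^sup>+" by blast
    then show ?case
      by (cases rule: trancl.cases) (use MD step.hyps(2) in \<open>blast intro: trancl_into_trancl\<close>)+
  qed
  have D_incr: "f x < f y" if "(x, y) \<in> ?D\<^sup>+" for x y
    using that by induction (use DU(2) less_trans in metis)+
  \<comment> \<open>Normal form of a path: new arcs first and old arcs last, since new arcs after an
    old one are absorbed.\<close>
  have split: "(x, y) \<in> ?D\<^sup>+ \<or> (\<exists>z. (x, z) \<in> ?D\<^sup>* \<and> (z, y) \<in> M\<^sup>+)" if "(x, y) \<in> E'\<^sup>+" for x y
    using that
  proof induction
    case (base y)
    then show ?case unfolding E'_def by blast
  next
    case (step y z)
    show ?case
    proof (cases "(y, z) \<in> M")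
      case True
      then show ?thesis using step.IH by (meson r_into_trancl trancl_into_rtrancl trancl_into_trancl)
    next
      case False
      then have yz: "(y, z) \<in> ?D" using step.hyps unfolding E'_def by blast
      then have "(y, z) \<in> ?D\<^sup>*" by blast
      then show ?thesis using step.IH yz absorb by (meson trancl_into_trancl)
    qed
  qed
  have acyc: "acyclic E'"
    unfolding acyclic_def
  proof (intro allI notI)
    fix x assume "(x, x) \<in> E'\<^sup>+"
    then consider "(x, x) \<in> ?D\<^sup>+" | z where "(x, z) \<in> ?D\<^sup>*" "(z, x) \<in> M\<^sup>+"
      using split by blast
    then show False
    proof cases
      case 1
      then show ?thesis using D_incr by blast
    next
      case 2
      \<comment> \<open>Rotated to start at \<open>z\<close>, the cycle has its new arcs last, where
        they are absorbed.\<close>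
      then have "(z, z) \<in> M\<^sup>+" using absorb by blast
      then have "(z, z) \<in> E\<^sup>+" using trancl_mono meek_closure_subset by metis
      then show ?thesis using acyclic unfolding acyclic_def by blast
    qed
  qed
  have adj': "adj E' x y \<longleftrightarrow> adj E x y" for x y
    using adj_cases[of x y] DU[of x y] DU[of y x] UD[of x y] und_edgesD(1)[of y x]
    unfolding E'_def adj_def[of "M \<union> ?D"] by blast
  have vM: "(u, x) \<in> M" if "(u, x) \<in> E" "(y, x) \<in> E" "u \<noteq> y" "\<not> adj E u y" for u x y
    using init_orient_vstruct(1)[OF that] meek_closure.init by metis
  have no_mixed: False if "(u, x) \<in> M" "(y, x) \<in> ?D" "\<not> adj E u y" for u x y
  proof -
    have "(u, y) \<in> M" using meek_chain_edge[OF that(1)] DU(1)[OF that(2)] und_edgesD(1) by blast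
    then show False using that(3) adj_cases[of u y] by blast
  qed
  have no_D: False if "(u, x) \<in> ?D" "(y, x) \<in> ?D" "u \<noteq> y" "\<not> adj E u y" for u x y
  proof -
    have "(u, y) \<in> U"
      using f that(1-3) unfolding moral_order_def clique_def orient_def by blast
    then show False using that(4) und_edgesD(3) by blast
  qed
  have "vstructs E' = vstructs E"
  proof (intro equalityI subsetI)
    fix t assume t: "t \<in> vstructs E'"
    obtain u x y where [simp]: "t = (u, x, y)" by (cases t)
    from t have v: "(u, x) \<in> E'" "(y, x) \<in> E'" "u \<noteq> y" "\<not> adj E u y"
      by (auto simp: vstructs_def adj')
    then have "(u, x) \<in> M \<and> (y, x) \<in> M"
      using no_mixed[of u x y] no_mixed[of y x u] no_D[of u x y] adj_sym[of E u y] unfolding E'_def by blast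
    then show "t \<in> vstructs E"
      using v meek_closure_arc[of u x] meek_closure_arc[of y x] by (auto simp: vstructs_def)
  next
    fix t assume t: "t \<in> vstructs E"
    obtain u x y where [simp]: "t = (u, x, y)" by (cases t)
    from t have v: "(u, x) \<in> E" "(y, x) \<in> E" "u \<noteq> y" "\<not> adj E u y"
      by (auto simp: vstructs_def)
    then have "(u, x) \<in> E'" "(y, x) \<in> E'"
      using vM[of u x y] vM[of y x u] adj_sym[of E u y] unfolding E'_def by blast+
    then show "t \<in> vstructs E'"
      using v(3,4) adj' unfolding vstructs_def by simp
  qed
  moreover have "adj E' = adj E" using adj' by (intro ext)
  moreover have "E' \<subseteq> V \<times> V"
    using meek_closure_subset V(2) unfolding E'_def orient_def by blast
  ultimately show "E' \<in> mec V E"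
    unfolding mec_def dag_def skeleton_def using acyc by simp
  show "covered E' x y" if cov: "covered ?D x y"
  proof -
    have xy: "(x, y) \<in> ?D" using cov unfolding covered_def by blast
    have "(z, x) \<in> M \<longleftrightarrow> (z, y) \<in> M" for z
      using meek_chain_edge DU(1)[OF xy] und_edgesD(1) by blast
    moreover have "(x, y) \<notin> M" using DU(1)[OF xy] und_edgesD(4) by blast
    ultimately show ?thesis
      using cov unfolding covered_def E'_def by blast
  qed
qed

end


section \<open>Moral orders of chordal graphs\<close>

lemma chordal_on_subset: "chordal_on U S \<Longrightarrow> T \<subseteq> S \<Longrightarrow> chordal_on U T"
  unfolding chordal_on_def by simp

lemma clique_subset: "clique U K \<Longrightarrow> L \<subseteq> K \<Longrightarrow> clique U L"
  unfolding clique_def by blast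

text \<open>If a simplicial vertex \<open>x\<close> lies in \<open>K\<close>, it is removed and the
  induction is applied to its neighbourhood, a clique containing \<open>K - {x}\<close>. The vertex
  found is not adjacent to \<open>x\<close>, so it remains simplicial in \<open>S\<close>.\<close>

lemma simplicial_outside_clique:
  assumes "finite S" "sym U" "chordal_on U S" "clique U K" "K \<subset> S"
  shows "\<exists>s\<in>S - K. clique U {y \<in> S. (s, y) \<in> U}"
  using assms
proof (induction "card S" arbitrary: S K rule: less_induct)
  case less
  obtain x where x: "x \<in> S" and sx: "clique U {y \<in> S. (x, y) \<in> U}"
    using less.prems(3,5) unfolding chordal_on_def by blast
  let ?N = "{y \<in> S - {x}. (x, y) \<in> U}"
  have N: "clique U ?N" using sx by (rule clique_subset) auto
  show ?case
  proof (cases "x \<in> K")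
    case False
    then show ?thesis using x sx by blast
  next
    case True
    then have KN: "K - {x} \<subseteq> ?N"
      using less.prems(4,5) unfolding clique_def by auto
    show ?thesis
    proof (cases "?N = S - {x}")
      case True
      have "clique U S"
        unfolding clique_def
      proof (intro ballI impI)
        fix y z assume yz: "y \<in> S" "z \<in> S" "y \<noteq> z"
        have nb: "(x, u) \<in> U" if "u \<in> S" "u \<noteq> x" for u
          using True that by blast
        show "(y, z) \<in> U"
        proof (cases "y = x \<or> z = x")
          case True
          then show ?thesis using nb yz symD[OF less.prems(2)] by metis
        next
          case False
          then have "y \<in> ?N" "z \<in> ?N" using nb yz by auto
          then show ?thesis using N yz(3) unfolding clique_def by blast
        qed
      qed
      then have "clique U {y \<in> S. (s, y) \<in> U}" for s
        by (rule clique_subset) auto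
      then show ?thesis using less.prems(5) by blast
    next
      case False
      then have "?N \<subset> S - {x}" by blast
      moreover have "card (S - {x}) < card S"
        using x less.prems(1) by (intro card_Diff1_less)
      ultimately obtain s where s: "s \<in> (S - {x}) - ?N" "clique U {y \<in> S - {x}. (s, y) \<in> U}"
        using less.hyps[of "S - {x}" ?N] N less.prems chordal_on_subset[of U S "S - {x}"] by auto
      have "(s, x) \<notin> U" using s(1) less.prems(2) unfolding sym_def by blast
      then have "{y \<in> S. (s, y) \<in> U} = {y \<in> S - {x}. (s, y) \<in> U}" by auto
      then have "clique U {y \<in> S. (s, y) \<in> U}" "s \<in> S - K" using s KN by auto
      then show ?thesis by blast
    qed
  qed
qed

lemma moral_orderI:
  assumes "inj_on f S" "irrefl U" "\<And>x. x \<in> S \<Longrightarrow> clique U {y \<in> S. (y, x) \<in> U \<and> f y < f x}"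
  shows "moral_order U S f"
proof -
  have "f x \<noteq> f y" if "x \<in> S" "y \<in> S" "(x, y) \<in> U" for x y
    using inj_onD[OF assms(1) _ that(1,2)] irreflD[OF assms(2)] that(3) by metis
  then show ?thesis using assms(3) unfolding moral_order_def by blast
qed

text \<open>Simplicial vertices outside the clique are removed one by one and placed last, until
  only the clique remains, for which any order is moral.\<close>

lemma moral_order_clique_prefix:
  assumes "finite S" "sym U" "chordal_on U S" "distinct K" "set K \<subseteq> S" "clique U (set K)"
    "irrefl U"
  shows "\<exists>f. inj_on f S \<and> moral_order U S f \<and> (\<forall>j<length K. f (K ! j) = j)"
  using assms
proof (induction "card S" arbitrary: S rule: less_induct)
  case less
  show ?case
  proof (cases "set K = S")
    case True
    let ?f = "the_inv_into {..<length K} (nth K)"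
    have inj: "inj_on (nth K) {..<length K}" and im: "nth K ` {..<length K} = S"
      using less.prems(4) True by (auto simp: inj_on_nth set_conv_nth)
    have "inj_on ?f S" using inj_on_the_inv_into[OF inj] im by simp
    moreover have "\<forall>j<length K. ?f (K ! j) = j"
      using the_inv_into_f_f[OF inj] by simp
    moreover have "clique U {y \<in> S. (y, x) \<in> U \<and> ?f y < ?f x}" for x
      using less.prems(6) True by (auto intro: clique_subset)
    ultimately show ?thesis
      using moral_orderI[of _ S U] less.prems(7) by blast
  next
    case False
    then obtain s where s: "s \<in> S" "s \<notin> set K" "clique U {y \<in> S. (s, y) \<in> U}"
      using simplicial_outside_clique[of S U "set K"] less.prems by blast
    have "card (S - {s}) < card S"
      using s less.prems(1) by (intro card_Diff1_less)
    then obtain f where f: "inj_on f (S - {s})" "moral_order U (S - {s}) f"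
      "\<forall>j<length K. f (K ! j) = j"
      using less.hyps[of "S - {s}"] less.prems s chordal_on_subset[of U S "S - {s}"] by auto
    have "finite (f ` (S - {s}))" using less.prems(1) by simp
    then obtain m where m: "f x < m" if "x \<in> S - {s}" for x
      using finite_nat_set_iff_bounded[of "f ` (S - {s})"] by blast
    \<comment> \<open>As \<open>m\<close> exceeds all other values, \<open>s\<close> precedes no
      other vertex, and its own predecessors lie in its simplicial neighbourhood.\<close>
    let ?f = "f(s := m)"
    have "inj_on ?f S"
    proof (rule inj_onI)
      fix x y assume "x \<in> S" "y \<in> S" "?f x = ?f y"
      then show "x = y"
        using m[of x] m[of y] inj_onD[OF f(1), of x y] by (auto split: if_splits)
    qed
    moreover have "\<forall>j<length K. ?f (K ! j) = j" using f(3) s(2) by auto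
    moreover have "clique U {y \<in> S. (y, x) \<in> U \<and> ?f y < ?f x}" if x: "x \<in> S" for x
    proof (cases "x = s")
      case True
      have "{y \<in> S. (y, x) \<in> U \<and> ?f y < ?f x} \<subseteq> {y \<in> S. (s, y) \<in> U}"
        using True less.prems(2) unfolding sym_def by blast
      then show ?thesis using s(3) clique_subset by blast
    next
      case False
      have "{y \<in> S. (y, x) \<in> U \<and> ?f y < ?f x} \<subseteq> {y \<in> S - {s}. (y, x) \<in> U \<and> f y < f x}"
        using False m[of x] x by auto
      moreover have "clique U {y \<in> S - {s}. (y, x) \<in> U \<and> f y < f x}"
        using f(2) False x unfolding moral_order_def by simp
      ultimately show ?thesis using clique_subset by blast
    qed
    ultimately show ?thesis
      using moral_orderI[of _ S U] less.prems(7) by blast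
  qed
qed

text \<open>By injectivity the values below \<open>i\<close> are used up by \<open>K\<close>, so the
  parents of \<open>K ! i\<close> are exactly the preceding entries.\<close>

lemma covered_clique_prefix:
  assumes "inj_on f S" "\<forall>j<length K. f (K ! j) = j" "distinct K" "set K \<subseteq> S" "clique U (set K)"
    and "Suc j < length K"
  shows "covered (orient U S f) (K ! j) (K ! Suc j)"
proof -
  have arcs: "(z, K ! i) \<in> orient U S f \<longleftrightarrow> (\<exists>l<i. z = K ! l)" if i: "i < length K" for i z
  proof
    assume "(z, K ! i) \<in> orient U S f"
    then have z: "z \<in> S" "f z < i" using assms(2) i by (auto simp: orient_def)
    then have "f (K ! f z) = f z" using assms(2) i by simp
    moreover have "K ! f z \<in> S" using assms(4) z i by (meson less_trans nth_mem subsetD)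
    ultimately have "K ! f z = z" using inj_onD[OF assms(1)] z by blast
    then show "\<exists>l<i. z = K ! l" using z(2) by metis
  next
    assume "\<exists>l<i. z = K ! l"
    then obtain l where l: "l < i" "z = K ! l" by blast
    then have "K ! l \<noteq> K ! i" using assms(3) i by (simp add: nth_eq_iff_index_eq)
    moreover have "K ! l \<in> set K" "K ! i \<in> set K" using l i by auto
    ultimately show "(z, K ! i) \<in> orient U S f"
      using l i assms(2,4,5) unfolding orient_def clique_def by auto
  qed
  show ?thesis
    unfolding covered_def using arcs[of j] arcs[of "Suc j"] assms(6) by (auto simp: less_Suc_eq)
qed

section \<open>Weights of vertex covers of a path\<close>

text \<open>Each vertex outside \<open>J\<close> except the first is charged to its predecessor,
  which is in \<open>J\<close> and at least as heavy. The second clause carries the induction and is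
  the form needed for \<open>zeta2\<close>.\<close>

lemma path_cover_weight:
  fixes w :: "'a \<Rightarrow> real"
  assumes "K \<noteq> []" "distinct K" "sorted_wrt (\<lambda>x y. w y \<le> w x) K" "\<forall>x\<in>set K. 0 \<le> w x"
    and "\<forall>j. Suc j < length K \<longrightarrow> K ! j \<in> J \<or> K ! Suc j \<in> J"
  shows "sum w (set K) \<le> w (hd K) + 2 * sum w (J \<inter> set K) \<and>
    (hd K \<in> J \<longrightarrow> sum w (set K) \<le> 2 * sum w (J \<inter> set K))"
  using assms
proof (induction K)
  case Nil
  then show ?case by simp
next
  case (Cons a K)
  show ?case
  proof (cases K)
    case Nil
    then show ?thesis using Cons.prems(4) sum_nonneg[of "J \<inter> {a}" w] by auto
  next
    case (Cons b L)
    have nonempty: "K \<noteq> []" and b: "hd K = b" "w b \<le> w a" "0 \<le> w b"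
      using Cons Cons.prems by auto
    have step: "\<forall>j. Suc j < length K \<longrightarrow> K ! j \<in> J \<or> K ! Suc j \<in> J"
      using Cons.prems(5) by (metis Suc_less_eq length_Cons nth_Cons_Suc)
    have ab: "a \<in> J \<or> b \<in> J"
      using Cons.prems(5)[rule_format, of 0] Cons by simp
    have IH: "sum w (set K) \<le> w b + 2 * sum w (J \<inter> set K)"
      "b \<in> J \<Longrightarrow> sum w (set K) \<le> 2 * sum w (J \<inter> set K)"
      using Cons.IH[OF nonempty] Cons.prems step b by auto
    have a: "a \<notin> set K" using Cons.prems(2) by simp
    have sum_a: "sum w (set (a # K)) = w a + sum w (set K)" using a by simp
    have "sum w (J \<inter> set (a # K)) = (if a \<in> J then w a else 0) + sum w (J \<inter> set K)"
      using a by (simp add: Int_insert_right)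
    then show ?thesis
      using sum_a IH ab b Cons.prems(4) by (auto split: if_splits)
  qed
qed

lemma descending_enumeration:
  fixes w :: "'a \<Rightarrow> real"
  assumes "finite K"
  obtains L where "set L = K" "distinct L" "sorted_wrt (\<lambda>x y. w y \<le> w x) L"
proof -
  obtain xs where xs: "set xs = K" "distinct xs" using finite_distinct_list[OF assms] by blast
  have "sorted (map (\<lambda>x. - w x) (sort_key (\<lambda>x. - w x) xs))" by simp
  then have "sorted_wrt (\<lambda>x y. w y \<le> w x) (sort_key (\<lambda>x. - w x) xs)"
    by (simp add: sorted_map)
  then show thesis using that[of "sort_key (\<lambda>x. - w x) xs"] xs by simp
qed

section \<open>Gluing orders along components\<close>

lemma component_self: "x \<in> S \<Longrightarrow> x \<in> component S U x"
  unfolding component_def by simp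

lemma component_eq:
  assumes "sym U" "y \<in> component S U x"
  shows "component S U y = component S U x"
proof -
  let ?R = "U \<inter> S \<times> S"
  have "sym (?R\<^sup>*)" using assms(1) by (intro sym_rtrancl) (auto simp: sym_def)
  moreover have "(x, y) \<in> ?R\<^sup>*" using assms(2) unfolding component_def by simp
  ultimately have "(y, z) \<in> ?R\<^sup>* \<longleftrightarrow> (x, z) \<in> ?R\<^sup>*" for z
    by (meson rtrancl_trans symD)
  then show ?thesis unfolding component_def by simp
qed

lemma component_edge: "(x, y) \<in> U \<Longrightarrow> x \<in> S \<Longrightarrow> y \<in> S \<Longrightarrow> y \<in> component S U x"
  unfolding component_def by blast

lemma components_eq_component:
  assumes "sym U" "D \<in> components S U" "x \<in> D"
  shows "D = component S U x"
proof -
  obtain y where "D = component S U y" using assms(2) unfolding components_def by blast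
  then show ?thesis using component_eq[OF assms(1)] assms(3) by simp
qed

lemma components_subset: "D \<in> components S U \<Longrightarrow> D \<subseteq> S"
  unfolding components_def component_def by blast

lemma components_nonempty: "D \<in> components S U \<Longrightarrow> D \<noteq> {}"
  unfolding components_def using component_self by fastforce

lemma components_edge_closed:
  assumes "sym U" "D \<in> components S U" "x \<in> D" "y \<in> S" "(x, y) \<in> U"
  shows "y \<in> D"
proof -
  have "x \<in> S" using components_subset[OF assms(2)] assms(3) by blast
  then show ?thesis
    using components_eq_component[OF assms(1-3)] component_edge[OF assms(5)] assms(4) by simp
qed

lemma sum_components:
  fixes w :: "'a \<Rightarrow> real"
  assumes "finite S" "sym U"
  shows "(\<Sum>D\<in>components S U. sum w (J \<inter> D)) = sum w (J \<inter> S)"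
proof -
  have "finite (components S U)" using assms(1) by (simp add: components_def)
  moreover have "\<forall>D\<in>components S U. finite (J \<inter> D)"
    using components_subset assms(1) by (metis finite_Int finite_subset)
  moreover have "\<forall>D\<in>components S U. \<forall>D'\<in>components S U. D \<noteq> D' \<longrightarrow> (J \<inter> D) \<inter> (J \<inter> D') = {}"
    using components_eq_component[OF assms(2)] by blast
  ultimately have "sum w (\<Union>D\<in>components S U. J \<inter> D) = (\<Sum>D\<in>components S U. sum w (J \<inter> D))"
    by (rule sum.UNION_disjoint)
  moreover have "(\<Union>D\<in>components S U. J \<inter> D) = J \<inter> S"
  proof (intro equalityI subsetI)
    fix x assume "x \<in> J \<inter> S"
    then show "x \<in> (\<Union>D\<in>components S U. J \<inter> D)"
      using component_self[of x S U] by (auto simp: components_def)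
  qed (use components_subset in blast)
  ultimately show ?thesis by simp
qed

text \<open>The set \<open>A\<close> of vertices preceding everything else is empty when gluing the chain components,
  and the singleton of the first vertex when gluing the components that remain after its removal.\<close>

lemma glue_moral_orders:
  assumes U: "sym U" and A: "clique U A" "inj_on h A" "A \<inter> S = {}" "irrefl U"
    and g: "\<And>D. D \<in> components S U \<Longrightarrow> moral_order U (A \<union> D) (g D)"
    and gA: "\<And>D a. D \<in> components S U \<Longrightarrow> a \<in> A \<Longrightarrow> g D a = h a"
    and gD: "\<And>D a d. D \<in> components S U \<Longrightarrow> a \<in> A \<Longrightarrow> d \<in> D \<Longrightarrow> h a < g D d"
  obtains f where "moral_order U (A \<union> S) f"
    and "\<And>D x y. D \<in> components S U \<Longrightarrow> covered (orient U (A \<union> D) (g D)) x y \<Longrightarrow>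
      covered (orient U (A \<union> S) f) x y"
proof -
  define f where "f x = (if x \<in> A then h x else g (component S U x) x)" for x
  have fA: "f a = h a" if "a \<in> A" for a using that by (simp add: f_def)
  have fD: "f x = g D x" if "D \<in> components S U" "x \<in> A \<union> D" for D x
    using that A(3) gA[OF that(1)] components_eq_component[OF U that(1)] components_subset[OF that(1)]
    by (auto simp: f_def)
  have nbr: "z \<in> A \<union> D" if "D \<in> components S U" "y \<in> D" "z \<in> A \<union> S" "(z, y) \<in> U" for D y z
    using that components_edge_closed[OF U that(1,2), of z] U unfolding sym_def by blast
  have nbrA: "z \<in> A" if "y \<in> A" "z \<in> A \<union> S" "f z < f y" for y z
  proof (rule ccontr)
    assume "z \<notin> A"
    then have "component S U z \<in> components S U" "z \<in> component S U z"
      using that component_self[of z S U] unfolding components_def by auto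
    then have "f y < f z" using gD that(1) fA fD[of "component S U z" z] by simp
    then show False using that(3) by simp
  qed
  \<comment> \<open>All parents of a vertex of \<open>A \<union> D\<close> lie in
    \<open>A \<union> D\<close>, so passing to the glued order preserves full parent sets and with
    them coveredness.\<close>
  have arcs: "(z, y) \<in> orient U (A \<union> S) f \<longleftrightarrow> (z, y) \<in> orient U (A \<union> D) (g D)"
    if D: "D \<in> components S U" and y: "y \<in> A \<union> D" for D y z
  proof
    assume *: "(z, y) \<in> orient U (A \<union> S) f"
    then have "z \<in> A \<union> D"
      using nbr[OF D, of y z] nbrA[of y z] y unfolding orient_def by blast
    then show "(z, y) \<in> orient U (A \<union> D) (g D)"
      using * y fD[OF D] unfolding orient_def by simp
  next
    assume "(z, y) \<in> orient U (A \<union> D) (g D)"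
    then show "(z, y) \<in> orient U (A \<union> S) f"
      using fD[OF D] components_subset[OF D] unfolding orient_def by auto
  qed
  have comp: "component S U x \<in> components S U" "x \<in> component S U x" if "x \<in> S" for x
    using that component_self by (auto simp: components_def)
  have "f x \<noteq> f y" if xy: "x \<in> A \<union> S" "y \<in> A \<union> S" "(x, y) \<in> U" for x y
  proof (cases "x \<in> A \<and> y \<in> A")
    case True
    then show ?thesis using fA A(2,4) xy(3) unfolding irrefl_def by (metis inj_on_contraD)
  next
    case False
    then obtain D where D: "D \<in> components S U" "x \<in> A \<union> D" "y \<in> A \<union> D"
      using xy nbr comp U unfolding sym_def by (metis UnE UnI2)
    then show ?thesis using g[OF D(1)] fD xy(3) unfolding moral_order_def by metis
  qed
  moreover have "clique U {y \<in> A \<union> S. (y, x) \<in> U \<and> f y < f x}" if x: "x \<in> A \<union> S" for x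
  proof (cases "x \<in> A")
    case True
    then have "{y \<in> A \<union> S. (y, x) \<in> U \<and> f y < f x} \<subseteq> A" using nbrA by blast
    then show ?thesis using A(1) clique_subset by blast
  next
    case False
    define D where "D = component S U x"
    have D: "D \<in> components S U" "x \<in> D" using comp[of x] x False unfolding D_def by auto
    have "{y \<in> A \<union> S. (y, x) \<in> U \<and> f y < f x} = {y. (y, x) \<in> orient U (A \<union> S) f}"
      using x unfolding orient_def by blast
    also have "\<dots> = {y. (y, x) \<in> orient U (A \<union> D) (g D)}"
      using arcs[OF D(1)] D(2) by blast
    also have "\<dots> = {y \<in> A \<union> D. (y, x) \<in> U \<and> g D y < g D x}"
      using D(2) unfolding orient_def by blast
    finally show ?thesis using g[OF D(1)] D(2) unfolding moral_order_def by auto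
  qed
  ultimately have "moral_order U (A \<union> S) f" unfolding moral_order_def by blast
  moreover have "covered (orient U (A \<union> S) f) x y"
    if "D \<in> components S U" "covered (orient U (A \<union> D) (g D)) x y" for D x y
  proof -
    have "x \<in> A \<union> D" "y \<in> A \<union> D" using that(2) unfolding covered_def orient_def by blast+
    then show ?thesis using that(2) arcs[OF that(1)] unfolding covered_def by simp
  qed
  ultimately show thesis using that by blast
qed

section \<open>Covers of the covered edges\<close>

text \<open>The order is fixed before \<open>J\<close>, because a single class member has to bound
  all its verifying sets.\<close>

lemma zeta1_order:
  fixes w :: "'a \<Rightarrow> real"
  assumes C: "finite C" "C \<noteq> {}" "chordal_on U C" and U: "sym U" "irrefl U"
    and w: "\<forall>x\<in>C. 0 \<le> w x"
  obtains f where "moral_order U C f"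
    and "\<And>J. (\<And>x y. covered (orient U C f) x y \<Longrightarrow> x \<in> J \<or> y \<in> J) \<Longrightarrow> zeta1 U C w \<le> sum w (J \<inter> C)"
proof -
  let ?Ks = "{K. K \<subseteq> C \<and> K \<noteq> {} \<and> clique U K}"
  let ?Z = "(\<lambda>K. sum w K - Max (w ` K)) ` ?Ks"
  obtain c where "c \<in> C" using C(2) by blast
  then have "{c} \<in> ?Ks" by (auto simp: clique_def)
  then have "Max ?Z \<in> ?Z"
    using C(1) by (intro Max_in) (auto intro: finite_subset)
  moreover have "zeta1 U C w = 1/2 * Max ?Z"
    unfolding zeta1_def by (intro arg_cong[where f = "\<lambda>Z. 1/2 * Max Z"]) blast
  ultimately obtain K where K: "K \<subseteq> C" "K \<noteq> {}" "clique U K"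
    and zeta: "zeta1 U C w = 1/2 * (sum w K - Max (w ` K))" by auto
  have finK: "finite K" using K(1) C(1) finite_subset by blast
  obtain L where L: "set L = K" "distinct L" "sorted_wrt (\<lambda>x y. w y \<le> w x) L"
    using descending_enumeration[OF finK] by blast
  obtain f where f: "inj_on f C" "moral_order U C f" "\<forall>j<length L. f (L ! j) = j"
    using moral_order_clique_prefix[OF C(1) U(1) C(3) L(2) _ _ U(2)] K L(1) by auto
  have "zeta1 U C w \<le> sum w (J \<inter> C)"
    if J: "\<And>x y. covered (orient U C f) x y \<Longrightarrow> x \<in> J \<or> y \<in> J" for J
  proof -
    have "\<forall>j. Suc j < length L \<longrightarrow> L ! j \<in> J \<or> L ! Suc j \<in> J"
      using covered_clique_prefix[OF f(1,3) L(2)] J K L(1) by simp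
    then have "sum w K \<le> w (hd L) + 2 * sum w (J \<inter> K)"
      using path_cover_weight[of L w J] L K w by auto
    moreover have "w (hd L) \<le> Max (w ` K)"
      using finK K(2) L(1) by (intro Max_ge) auto
    moreover have "sum w (J \<inter> K) \<le> sum w (J \<inter> C)"
      using C(1) K(1) w by (intro sum_mono2) auto
    ultimately show ?thesis using zeta by simp
  qed
  then show thesis using that f(2) by blast
qed

text \<open>The covered edge from \<open>v\<close> to the first vertex of a nonempty clique forces
  the latter into \<open>J\<close>, so the path bound loses nothing. The value 0 at \<open>v\<close>
  and positive values elsewhere prepare the gluing.\<close>

lemma max_weight_clique_order:
  fixes w :: "'a \<Rightarrow> real"
  assumes D: "finite D" "v \<notin> D" "chordal_on U (insert v D)" and U: "sym U" "irrefl U"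
    and w: "\<forall>x\<in>D. 0 \<le> w x" and N: "N \<subseteq> D" "\<And>u. u \<in> N \<Longrightarrow> (v, u) \<in> U"
  shows "\<exists>f. moral_order U (insert v D) f \<and> f v = 0 \<and> (\<forall>d\<in>D. 0 < f d) \<and>
    (\<forall>J. v \<notin> J \<longrightarrow> (\<forall>x y. covered (orient U (insert v D) f) x y \<longrightarrow> x \<in> J \<or> y \<in> J) \<longrightarrow>
      Max {sum w K | K. K \<subseteq> N \<and> clique U K} \<le> 2 * sum w (J \<inter> D))"
proof -
  let ?Ks = "{K. K \<subseteq> N \<and> clique U K}"
  have "{} \<in> ?Ks" by (auto simp: clique_def)
  moreover have "finite ?Ks" using finite_subset[OF N(1) D(1)] by auto
  ultimately have "Max (sum w ` ?Ks) \<in> sum w ` ?Ks" by (intro Max_in) auto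
  moreover have "{sum w K | K. K \<subseteq> N \<and> clique U K} = sum w ` ?Ks" by blast
  ultimately obtain K where K: "K \<subseteq> N" "clique U K"
    and max: "Max {sum w K | K. K \<subseteq> N \<and> clique U K} = sum w K" by auto
  have KD: "K \<subseteq> D" using K(1) N(1) by blast
  then have finK: "finite K" using D(1) finite_subset by blast
  obtain L where L: "set L = K" "distinct L" "sorted_wrt (\<lambda>x y. w y \<le> w x) L"
    using descending_enumeration[OF finK] by blast
  have vL: "distinct (v # L)" "set (v # L) \<subseteq> insert v D" using L KD D(2) by auto
  have cl: "clique U (set (v # L))"
    unfolding clique_def
  proof (intro ballI impI)
    fix x y assume xy: "x \<in> set (v # L)" "y \<in> set (v # L)" "x \<noteq> y"
    then consider "x = v" "y \<in> K" | "y = v" "x \<in> K" | "x \<in> K" "y \<in> K"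
      using L(1) by auto
    then show "(x, y) \<in> U"
      using xy(3) N(2) K symD[OF U(1)] unfolding clique_def by cases blast+
  qed
  obtain f where f: "inj_on f (insert v D)" "moral_order U (insert v D) f"
    "\<forall>j<length (v # L). f ((v # L) ! j) = j"
    using moral_order_clique_prefix[OF _ U(1) D(3) vL cl U(2)] D(1) by auto
  have fv: "f v = 0" using f(3)[rule_format, of 0] by simp
  have pos: "0 < f d" if "d \<in> D" for d
    using inj_onD[OF f(1), of d v] fv that D(2) by auto
  have "sum w K \<le> 2 * sum w (J \<inter> D)"
    if J: "v \<notin> J" "\<And>x y. covered (orient U (insert v D) f) x y \<Longrightarrow> x \<in> J \<or> y \<in> J" for J
  proof -
    have cov: "(v # L) ! j \<in> J \<or> (v # L) ! Suc j \<in> J" if "j < length L" for j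
      using covered_clique_prefix[OF f(1,3) vL cl] J(2) that by simp
    have "sum w K \<le> 2 * sum w (J \<inter> K)"
    proof (cases "L = []")
      case True
      then show ?thesis using L(1) by auto
    next
      case False
      have "hd L \<in> J" using cov[of 0] J(1) False by (simp add: hd_conv_nth)
      moreover have "\<forall>j. Suc j < length L \<longrightarrow> L ! j \<in> J \<or> L ! Suc j \<in> J"
        using cov by force
      ultimately show ?thesis
        using path_cover_weight[OF False L(2,3), of J] L(1) KD w by blast
    qed
    moreover have "sum w (J \<inter> K) \<le> sum w (J \<inter> D)"
      using D(1) KD w by (intro sum_mono2) auto
    ultimately show ?thesis by simp
  qed
  then show ?thesis using f(2) fv pos max by auto
qed

text \<open>A cover containing \<open>v\<close> pays \<open>w v\<close> outright; one avoiding
  \<open>v\<close> pays half of the best clique in each component of the rest, hence half of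
  \<open>gamma\<close>. The minimum accounts for both cases.\<close>

lemma zeta2_order:
  fixes w :: "'a \<Rightarrow> real"
  assumes C: "finite C" "C \<noteq> {}" "chordal_on U C" and U: "sym U" "irrefl U"
    and w: "\<forall>x\<in>C. 0 \<le> w x"
  obtains f where "moral_order U C f"
    and "\<And>J. (\<And>x y. covered (orient U C f) x y \<Longrightarrow> x \<in> J \<or> y \<in> J) \<Longrightarrow> zeta2 U C w \<le> sum w (J \<inter> C)"
proof -
  let ?m = "\<lambda>v. min (w v) (gamma U C v w)"
  have "Max (?m ` C) \<in> ?m ` C" using C(1,2) by (intro Max_in) auto
  then obtain v where v: "v \<in> C" and zeta: "zeta2 U C w = 1/2 * ?m v"
    unfolding zeta2_def by auto
  let ?S = "C - {v}"
  let ?N = "\<lambda>D. D \<inter> {u \<in> C. (v, u) \<in> U}"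
  let ?good = "\<lambda>D f. moral_order U (insert v D) f \<and> f v = 0 \<and> (\<forall>d\<in>D. 0 < f d) \<and>
    (\<forall>J. v \<notin> J \<longrightarrow> (\<forall>x y. covered (orient U (insert v D) f) x y \<longrightarrow> x \<in> J \<or> y \<in> J) \<longrightarrow>
      Max {sum w K | K. K \<subseteq> ?N D \<and> clique U K} \<le> 2 * sum w (J \<inter> D))"
  have "\<exists>f. ?good D f" if D: "D \<in> components ?S U" for D
  proof (rule max_weight_clique_order[OF _ _ _ U])
    have DS: "D \<subseteq> ?S" using components_subset[OF D] .
    then show "finite D" "v \<notin> D" "\<forall>x\<in>D. 0 \<le> w x"
      using C(1) w finite_subset[of D C] by auto
    have "insert v D \<subseteq> C" using DS v by blast
    then show "chordal_on U (insert v D)" using chordal_on_subset[OF C(3)] by blast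
  qed auto
  then have "\<forall>D\<in>components ?S U. \<exists>f. ?good D f" by blast
  from bchoice[OF this] obtain g where "\<forall>D\<in>components ?S U. ?good D (g D)" ..
  then have g: "?good D (g D)" if "D \<in> components ?S U" for D using that by (rule bspec)
  have ins: "{v} \<union> D = insert v D" for D by simp
  \<comment> \<open>The orders of the components all begin with \<open>v\<close> at 0, so they agree
    there and can be glued.\<close>
  obtain f where f: "moral_order U ({v} \<union> ?S) f"
    and cov: "\<And>D x y. D \<in> components ?S U \<Longrightarrow> covered (orient U ({v} \<union> D) (g D)) x y \<Longrightarrow>
      covered (orient U ({v} \<union> ?S) f) x y"
  proof (rule glue_moral_orders[OF U(1), of "{v}" "\<lambda>_. 0" ?S g])
    show "clique U {v}" by (simp add: clique_def)
    show "moral_order U ({v} \<union> D) (g D)" if "D \<in> components ?S U" for D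
      using g[OF that] by simp
    show "g D a = 0" if "D \<in> components ?S U" "a \<in> {v}" for D a
      using g[OF that(1)] that(2) by simp
    show "0 < g D d" if "D \<in> components ?S U" "a \<in> {v}" "d \<in> D" for D a d
      using g[OF that(1)] that(3) by simp
  qed (use U(2) in auto)
  have vS: "{v} \<union> ?S = C" using v by blast
  have "zeta2 U C w \<le> sum w (J \<inter> C)"
    if J: "\<And>x y. covered (orient U C f) x y \<Longrightarrow> x \<in> J \<or> y \<in> J" for J
  proof (cases "v \<in> J")
    case True
    have "w v \<le> sum w (J \<inter> C)"
      using True v C(1) w by (intro member_le_sum) auto
    moreover have "zeta2 U C w \<le> 1/2 * w v" using zeta by simp
    moreover have "0 \<le> w v" using v w by blast
    ultimately show ?thesis by linarith
  next
    case False
    have "gamma U C v w \<le> (\<Sum>D\<in>components ?S U. 2 * sum w (J \<inter> D))"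
      unfolding gamma_def
    proof (rule sum_mono)
      fix D assume D: "D \<in> components ?S U"
      have "\<forall>x y. covered (orient U (insert v D) (g D)) x y \<longrightarrow> x \<in> J \<or> y \<in> J"
        using cov[OF D] J vS ins by metis
      then show "Max {sum w K | K. K \<subseteq> ?N D \<and> clique U K} \<le> 2 * sum w (J \<inter> D)"
        using g[OF D] False by blast
    qed
    also have "\<dots> = 2 * sum w (J \<inter> ?S)"
      using sum_components[OF _ U(1), of ?S w J] C(1) by (simp add: sum_distrib_left[symmetric])
    also have "\<dots> \<le> 2 * sum w (J \<inter> C)"
      using C(1) w by (intro mult_left_mono sum_mono2) auto
    finally show ?thesis using zeta by linarith
  qed
  then show thesis using that f vS by simp
qed

text \<open>The larger of the two bounds decides which of the two orders is taken.\<close>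

lemma zeta_order:
  fixes w :: "'a \<Rightarrow> real"
  assumes "finite C" "C \<noteq> {}" "chordal_on U C" "sym U" "irrefl U" "\<forall>x\<in>C. 0 \<le> w x"
  shows "\<exists>f. moral_order U C f \<and> (\<forall>J. (\<forall>x y. covered (orient U C f) x y \<longrightarrow> x \<in> J \<or> y \<in> J) \<longrightarrow>
    max (zeta1 U C w) (zeta2 U C w) \<le> sum w (J \<inter> C))"
proof (cases "zeta1 U C w \<le> zeta2 U C w")
  case True
  then show ?thesis using zeta2_order[OF assms] by (metis max.absorb2)
next
  case False
  then show ?thesis using zeta1_order[OF assms] by (metis max.absorb1 linear)
qed

section \<open>The bound for a single member of the equivalence class\<close>

text \<open>The member \<open>E'\<close> depends on \<open>I\<close> but not on \<open>J\<close>, so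
  the bound holds for the minimum \<open>nu1\<close> of \<open>E'\<close>.\<close>

lemma mec_member_lower_bound:
  fixes w :: "'a \<Rightarrow> real"
  assumes V: "finite V" and E: "dag V E" and w: "\<forall>v\<in>V. 0 \<le> w v"
  obtains E' where "E' \<in> mec V E"
    and "\<And>J. J \<subseteq> V \<Longrightarrow> verifying E' J \<Longrightarrow>
      (\<Sum>C\<in>{C \<in> chain_components V E I. 2 \<le> card C}.
        max (zeta1 (und_edges E (ess_orient E I)) C w) (zeta2 (und_edges E (ess_orient E I)) C w))
      \<le> sum w J"
proof -
  have EV: "E \<subseteq> V \<times> V" "acyclic E" using E unfolding dag_def by auto
  then have finE: "finite E" using V finite_subset by blast
  interpret acyclic_arcs E I by unfold_locales (fact EV(2))
  have ess: "ess_orient E I = M" using ess_orient_eq_meek_closure[OF finE] .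
  have U: "sym U" "irrefl U"
    using und_edgesD(1,2) unfolding sym_def irrefl_def by blast+
  let ?Cs = "components V U"
  let ?z = "\<lambda>C. max (zeta1 U C w) (zeta2 U C w)"
  let ?good = "\<lambda>C f. moral_order U C f \<and>
    (\<forall>J. (\<forall>x y. covered (orient U C f) x y \<longrightarrow> x \<in> J \<or> y \<in> J) \<longrightarrow> ?z C \<le> sum w (J \<inter> C))"
  have "\<exists>f. ?good C f" if C: "C \<in> ?Cs" for C
  proof (rule zeta_order[OF _ _ _ U])
    have CV: "C \<subseteq> V" using components_subset[OF C] .
    then show fin: "finite C" using V finite_subset by blast
    show "C \<noteq> {}" using components_nonempty[OF C] .
    show "chordal_on U C" using chordal_und_edges[OF fin] .
    show "\<forall>x\<in>C. 0 \<le> w x" using CV w by blast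
  qed
  then have "\<forall>C\<in>?Cs. \<exists>f. ?good C f" by blast
  from bchoice[OF this] obtain g where "\<forall>C\<in>?Cs. ?good C (g C)" ..
  then have g: "?good C (g C)" if "C \<in> ?Cs" for C using that by (rule bspec)
  obtain f where f: "moral_order U ({} \<union> V) f"
    and cov: "\<And>C x y. C \<in> ?Cs \<Longrightarrow> covered (orient U ({} \<union> C) (g C)) x y \<Longrightarrow>
      covered (orient U ({} \<union> V) f) x y"
  proof (rule glue_moral_orders[OF U(1), of "{}" "\<lambda>_. 0" V g])
    show "clique U {}" by (simp add: clique_def)
    show "moral_order U ({} \<union> C) (g C)" if "C \<in> ?Cs" for C
      using g[OF that] by simp
  qed (use U(2) in auto)
  define E' where "E' = M \<union> orient U V f"
  have mec: "E' \<in> mec V E"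
    using meek_closure_reorient(1)[OF V EV(1)] f unfolding E'_def by simp
  have covE': "covered E' x y" if "C \<in> ?Cs" "covered (orient U C (g C)) x y" for C x y
    using meek_closure_reorient(2)[OF V EV(1)] f cov[OF that(1)] that(2) unfolding E'_def by simp
  have E'V: "E' \<subseteq> V \<times> V" "acyclic E'" using mec unfolding mec_def dag_def by auto
  have "(\<Sum>C\<in>{C \<in> ?Cs. 2 \<le> card C}. ?z C) \<le> sum w J" if J: "J \<subseteq> V" "verifying E' J" for J
  proof -
    \<comment> \<open>For the verifying set \<open>J\<close> the closure is all of
      \<open>E'\<close>, so \<open>J\<close> meets every covered edge of \<open>E'\<close>.\<close>
    interpret E': acyclic_arcs E' J by unfold_locales (fact E'V(2))
    have "finite E'" using E'V(1) V finite_subset by blast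
    then have "meek_closure E' J = E'"
      using E'.ess_orient_eq_meek_closure J(2) unfolding verifying_def by simp
    then have meets: "x \<in> J \<or> y \<in> J" if "covered E' x y" for x y
      using E'.verifying_meets_covered that unfolding covered_def by metis
    have "?z C \<le> sum w (J \<inter> C)" if "C \<in> ?Cs" for C
      using g[OF that] covE'[OF that] meets by blast
    then have "(\<Sum>C\<in>{C \<in> ?Cs. 2 \<le> card C}. ?z C) \<le> (\<Sum>C\<in>{C \<in> ?Cs. 2 \<le> card C}. sum w (J \<inter> C))"
      by (intro sum_mono) simp
    \<comment> \<open>Single-vertex components are added back with nonnegative terms, so that the
      components partition \<open>V\<close>.\<close>
    also have "\<dots> \<le> (\<Sum>C\<in>?Cs. sum w (J \<inter> C))"
      using V J(1) w by (intro sum_mono2 sum_nonneg) (auto simp: components_def)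
    also have "\<dots> = sum w (J \<inter> V)" using sum_components[OF V U(1)] .
    also have "J \<inter> V = J" using J(1) by blast
    finally show ?thesis .
  qed
  then show thesis
    using that[OF mec] unfolding chain_components_def ess by blast
qed

text \<open>Targeting every vertex orients every arc initially. This makes the set minimised in
  \<open>nu1\<close> nonempty.\<close>

lemma verifying_all:
  assumes "finite V" "dag V E"
  shows "verifying E V"
proof -
  have EV: "E \<subseteq> V \<times> V" "acyclic E" using assms unfolding dag_def by auto
  interpret acyclic_arcs E V by unfold_locales (fact EV(2))
  have "finite E" using EV(1) assms(1) finite_subset by blast
  moreover have "E \<subseteq> init_orient E V" using EV(1) unfolding init_orient_def by blast
  then have "E \<subseteq> M" by (auto intro: meek_closure.init)
  ultimately show ?thesis
    using ess_orient_eq_meek_closure meek_closure_subset unfolding verifying_def by blast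
qed

theorem mainTheorem3:
  fixes V :: "'a set" and E :: "('a \<times> 'a) set" and w :: "'a \<Rightarrow> real"
  assumes "finite V" and "dag V E" and "\<forall>v\<in>V. 0 \<le> w v"
  shows "lower_bound V E w \<le> nu1max V E w"
  unfolding lower_bound_def
proof (rule Max.boundedI)
  fix b assume "b \<in> (\<lambda>I. \<Sum>C\<in>{C \<in> chain_components V E I. 2 \<le> card C}.
        max (zeta1 (und_edges E (ess_orient E I)) C w) (zeta2 (und_edges E (ess_orient E I)) C w))
      ` Pow V"
  then obtain I where b: "b = (\<Sum>C\<in>{C \<in> chain_components V E I. 2 \<le> card C}.
        max (zeta1 (und_edges E (ess_orient E I)) C w) (zeta2 (und_edges E (ess_orient E I)) C w))"
    by blast
  obtain E' where E': "E' \<in> mec V E" and bound: "\<And>J. J \<subseteq> V \<Longrightarrow> verifying E' J \<Longrightarrow> b \<le> sum w J"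
    using mec_member_lower_bound[OF assms, of I] b by blast
  have "dag V E'" using E' unfolding mec_def by blast
  then have "V \<in> {J. J \<subseteq> V \<and> verifying E' J}" using verifying_all assms(1) by blast
  then have "b \<le> nu1 V E' w"
    unfolding nu1_def using assms(1) bound by (intro Min.boundedI) auto
  also have "mec V E \<subseteq> Pow (V \<times> V)" unfolding mec_def dag_def by blast
  then have "finite (mec V E)" using assms(1) finite_subset by blast
  then have "nu1 V E' w \<le> nu1max V E w"
    unfolding nu1max_def using E' by (intro Max_ge) auto
  finally show "b \<le> nu1max V E w" .
qed (use assms(1) in auto)

end
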